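(* Let $\Gamma$ be a virtual string, $n$ a positive integer and $r$ a non-negative integer. Let $k=0$ if $r=0$, and $k=r/d$ otherwise, where $d$ is the greatest common divisor of $n$ and $r$. Then $(\Gamma^{(k)})_{(n)}$ (the $n$-cable of the $k$-covering of $\Gamma$) and $(\Gamma_{(n)})^{(r)}$ (the $r$-covering of the $n$-cable of $\Gamma$) are homotopic, i.e. they are the same virtual string.
   Context: Nanowords. A Gauss word is a finite word (possibly empty) in which each letter appears exactly twice or not at all. A nanoword is a Gauss word together with a map $X\mapsto|X|\in\{a,b\}$ from its letters to $\{a,b\}$ ($|X|$ is the type of $X$). An isomorphism of nanowords is a type-preserving relabelling of letters which carries the $k$th letter of one word to the $k$th letter of the other for all $k$. Two nanowords are homotopic if related by a finite sequence of isomorphisms and the following moves and their inverses ($x,y,z,t$ are arbitrary sequences of letters such that both sides are Gauss words, types of letters being unchanged unless stated): shift: $AxAy\leftrightarrow xA'yA'$ where $|A'|\neq|A|$; H1: $xAAy\leftrightarrow xy$; H2: $xAByBAz\leftrightarrow xyz$ where $|A|\ne|B|$; H3: $xAByACzBCt\leftrightarrow xBAyCAzCBt$ where $|A|=|B|=|C|$. Virtual strings. A virtual string is (equivalently to its definition via planar diagrams with real and virtual crossings modulo flattened Reidemeister-type moves) a homotopy class of nanowords. A nanoword represents its class. Linking. Let $\alpha$ be a nanoword. Distinct letters $A,B$ are linked if they alternate in $\alpha$. Set $l(A,B)=0$ if $A=B$ or $A,B$ are not linked. If they occur in the order $\dots A\dots B\dots A\dots B\dots$, set $l(A,B)=1$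 if $|A|=|B|$ and $-1$ otherwise; if in the order $\dots B\dots A\dots B\dots A\dots$, set $l(A,B)=-1$ if $|A|=|B|$ and $1$ otherwise. Put $n(X)=\sum_{Y\in\alpha}l(X,Y)$, the sum over all letters $Y$ of $\alpha$. Coverings. For a non-negative integer $r$, the $r$-covering $\alpha^{(r)}$ of $\alpha$ is obtained by deleting from $\alpha$ (both occurrences of) every letter $X$ for which $n(X)$ (computed in $\alpha$) is not divisible by $r$ (for $r=0$: delete every $X$ with $n(X)\neq0$). It is known that homotopic nanowords have homotopic $r$-coverings, so for a virtual string $\Gamma$ represented by $\alpha$, $\Gamma^{(r)}$ is defined as the virtual string represented by $\alpha^{(r)}$. Cables. Let $n\ge1$ and let $\alpha$ be a nanoword. For $0\le i\le n-1$ let $w_i$ be obtained from $\alpha$ by replacing letters as follows (first indices modulo $n$): if $|A|=a$, replace the first occurrence of $A$ by $A_{i,0}A_{i,1}\dotso A_{i,n-1}$ and the second by $A_{n-1,i}A_{n-2,i}\dotso A_{0,i}$; if $|A|=b$, replace the first occurrence of $A$ by $A_{0,i}A_{n-1,i}A_{n-2,i}\dotso A_{1,i}$ and the second by $A_{i+1,0}A_{i+1,1}\dotso A_{i+1,n-1}$. The $n$-cable of $\alpha$ is the nanoword $$\alpha_{(n)}=w_0C_0w_1C_1\dotso C_{n-3}w_{n-2}C_{n-2}w_{n-1}C_{n-2}C_{n-3}\dotso C_1C_0$$ with types: all $C_i$ have type $a$; if $|A|=a$ then $|A_{i,j}|=a$ if $i\le j$ and $b$ if $i>j$; if $|A|=b$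 then, with $d\in\{0,\dots,n-1\}$ the residue of $i-1$ modulo $n$, $|A_{i,j}|=a$ if $j>d$ and $b$ if $j\le d$. (Geometrically: take $n$ parallel copies of the curve, numbered $0,\dots,n-1$ from left to right, cut at the base point; join the end of copy $i$ to the start of copy $i+1$ for $0\le i\le n-2$, and the end of copy $n-1$ to the start of copy $0$ crossing the other $n-1$ arcs.) Homotopic nanowords have homotopic $n$-cables, so for a virtual string $\Gamma$ represented by $\alpha$, $\Gamma_{(n)}$ is defined as the virtual string represented by $\alpha_{(n)}$. *)

theory Defs
  imports Main
begin

datatype letter_type = Type_a | Type_b

text \<open>One infinite alphabet, closed under cabling: in the n-cable, \<open>Crossing A i j\<close> is the letter
  $A_{i,j}$ and \<open>Joining i\<close> is $C_i$. The freeness of the constructors makes the letters of a cable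
  pairwise distinct. Up to isomorphism the choice of alphabet is immaterial.\<close>

datatype letter = Base nat | Crossing letter nat nat | Joining nat

text \<open>The type map is total; its values off the letters of the word carry no information, and
  are forgotten by isomorphism.\<close>

datatype nanoword = Nanoword (word: "letter list") (ltype: "letter \<Rightarrow> letter_type")

definition gauss_word :: "letter list \<Rightarrow> bool" where
  "gauss_word w \<longleftrightarrow> (\<forall>X \<in> set w. count_list w X = 2)"

definition is_nanoword :: "nanoword \<Rightarrow> bool" where
  "is_nanoword \<alpha> \<longleftrightarrow> gauss_word (word \<alpha>)"

text \<open>The elementary relations, from left to right. That both sides are Gauss words is required
  in \<open>homotopy_step\<close>; on each side it forces the displayed letters to be distinct from each other and
  from those of x, y, z, u.\<close>

inductive move :: "nanoword \<Rightarrow> nanoword \<Rightarrow> bool" where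
  iso: "inj_on f (set w) \<Longrightarrow> (\<And>X. X \<in> set w \<Longrightarrow> t' (f X) = t X) \<Longrightarrow>
    move (Nanoword w t) (Nanoword (map f w) t')"
| shift: "t' A' \<noteq> t A \<Longrightarrow> (\<And>X. X \<in> set x \<union> set y \<Longrightarrow> t' X = t X) \<Longrightarrow>
    move (Nanoword ([A] @ x @ [A] @ y) t) (Nanoword (x @ [A'] @ y @ [A']) t')"
| H1: "move (Nanoword (x @ [A, A] @ y) t) (Nanoword (x @ y) t)"
| H2: "t A \<noteq> t B \<Longrightarrow>
    move (Nanoword (x @ [A, B] @ y @ [B, A] @ z) t) (Nanoword (x @ y @ z) t)"
| H3: "t A = t B \<Longrightarrow> t B = t C \<Longrightarrow>
    move (Nanoword (x @ [A, B] @ y @ [A, C] @ z @ [B, C] @ u) t)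
         (Nanoword (x @ [B, A] @ y @ [C, A] @ z @ [C, B] @ u) t)"

definition homotopy_step :: "nanoword \<Rightarrow> nanoword \<Rightarrow> bool" where
  "homotopy_step \<alpha> \<beta> \<longleftrightarrow> is_nanoword \<alpha> \<and> is_nanoword \<beta> \<and> (move \<alpha> \<beta> \<or> move \<beta> \<alpha>)"

definition homotopic :: "nanoword \<Rightarrow> nanoword \<Rightarrow> bool" where
  "homotopic \<alpha> \<beta> \<longleftrightarrow> is_nanoword \<alpha> \<and> is_nanoword \<beta> \<and> homotopy_step\<^sup>*\<^sup>* \<alpha> \<beta>"

definition virtual_strings :: "nanoword set set" where
  "virtual_strings = {\<alpha>. is_nanoword \<alpha>} // {(\<alpha>, \<beta>). homotopic \<alpha> \<beta>}"

text \<open>A and B alternate in \<alpha>, beginning with A.\<close>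

definition alternate :: "nanoword \<Rightarrow> letter \<Rightarrow> letter \<Rightarrow> bool" where
  "alternate \<alpha> A B \<longleftrightarrow> A \<noteq> B \<and> filter (\<lambda>X. X = A \<or> X = B) (word \<alpha>) = [A, B, A, B]"

definition link :: "nanoword \<Rightarrow> letter \<Rightarrow> letter \<Rightarrow> int" where
  "link \<alpha> A B =
    (if alternate \<alpha> A B then (if ltype \<alpha> A = ltype \<alpha> B then 1 else - 1)
     else if alternate \<alpha> B A then (if ltype \<alpha> A = ltype \<alpha> B then - 1 else 1)
     else 0)"

definition link_sum :: "nanoword \<Rightarrow> letter \<Rightarrow> int" where
  "link_sum \<alpha> X = (\<Sum>Y \<in> set (word \<alpha>). link \<alpha> X Y)"

text \<open>For r = 0 this keeps exactly the letters with \<open>link_sum \<alpha> X = 0\<close>, since 0 divides only 0.\<close>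

definition covering :: "nat \<Rightarrow> nanoword \<Rightarrow> nanoword" where
  "covering r \<alpha> =
    Nanoword (filter (\<lambda>X. int r dvd link_sum \<alpha> X) (word \<alpha>)) (ltype \<alpha>)"

text \<open>The sequences replacing the first and the second occurrence of A in the i-th parallel
  copy (0 \<le> i < n).\<close>

fun first_block :: "nat \<Rightarrow> letter_type \<Rightarrow> nat \<Rightarrow> letter \<Rightarrow> letter list" where
  "first_block n Type_a i A = map (\<lambda>j. Crossing A i j) [0..<n]"
| "first_block n Type_b i A = map (\<lambda>j. Crossing A j i) (0 # rev [1..<n])"

fun second_block :: "nat \<Rightarrow> letter_type \<Rightarrow> nat \<Rightarrow> letter \<Rightarrow> letter list" where
  "second_block n Type_a i A = map (\<lambda>j. Crossing A j i) (rev [0..<n])"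
| "second_block n Type_b i A = map (\<lambda>j. Crossing A ((i + 1) mod n) j) [0..<n]"

text \<open>The word $w_i$; the occurrence at position p is the first one of its letter iff that letter
  does not occur among the first p letters.\<close>

definition parallel_copy :: "nat \<Rightarrow> nanoword \<Rightarrow> nat \<Rightarrow> letter list" where
  "parallel_copy n \<alpha> i = concat (map (\<lambda>p. let A = word \<alpha> ! p in
      if A \<notin> set (take p (word \<alpha>)) then first_block n (ltype \<alpha> A) i A
      else second_block n (ltype \<alpha> A) i A) [0..<length (word \<alpha>)])"

text \<open>For type b, \<open>(i + n - 1) mod n\<close> is the residue of i - 1 modulo n (subtraction on naturals
  truncates). The value on \<open>Base\<close> letters is irrelevant: they do not occur in a cable.\<close>

fun cable_type :: "nat \<Rightarrow> (letter \<Rightarrow> letter_type) \<Rightarrow> letter \<Rightarrow> letter_type" where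
  "cable_type n t (Crossing A i j) =
    (case t A of
       Type_a \<Rightarrow> if i \<le> j then Type_a else Type_b
     | Type_b \<Rightarrow> if j > (i + n - 1) mod n then Type_a else Type_b)"
| "cable_type n t (Joining i) = Type_a"
| "cable_type n t (Base m) = Type_a"

definition cable :: "nat \<Rightarrow> nanoword \<Rightarrow> nanoword" where
  "cable n \<alpha> = Nanoword
    (concat (map (\<lambda>i. parallel_copy n \<alpha> i @ [Joining i]) [0..<n - 1])
      @ parallel_copy n \<alpha> (n - 1) @ map Joining (rev [0..<n - 1]))
    (cable_type n (ltype \<alpha>))"

end

(* The two nanowords are in fact equal. Give the first occurrence of a letter of type a and the
   second occurrence of a letter of type b the sign +1, the other occurrences the sign -1, and let
   the height of an occurrence be the sum of the signs before it. Then n(X) is the height of the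
   negative occurrence of X minus that of the positive one, minus 1. In the n-cable each occurrence
   becomes n blocks (one per copy) of n letters of the same sign, whence n(A_{i,j}) = n * n(A) and
   n(C_i) = 0. As r divides n * m iff k divides m, the r-covering of the cable deletes precisely the
   letters A_{i,j} for which A is deleted in the k-covering. *)

theory Submission
  imports Defs
begin

section \<open>Signs and heights of occurrences\<close>

fun type_sign :: "letter_type \<Rightarrow> int" where
  "type_sign Type_a = 1"
| "type_sign Type_b = - 1"

lemma type_sign_neq_0 [simp]: "type_sign T \<noteq> 0"
  by (cases T) simp_all

text \<open>The type of a letter says which sign comes first.\<close>

definition signed_word :: "(letter \<Rightarrow> letter_type) \<Rightarrow> (letter \<times> int) list \<Rightarrow> bool" where
  "signed_word t s \<longleftrightarrow> (\<forall>X \<in> fst ` set s.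
    filter (\<lambda>z. fst z = X) s = [(X, type_sign (t X)), (X, - type_sign (t X))])"

lemma signed_wordD:
  assumes "signed_word t s" and "X \<in> fst ` set s"
  shows "filter (\<lambda>z. fst z = X) s = [(X, type_sign (t X)), (X, - type_sign (t X))]"
  using assms unfolding signed_word_def by blast

definition height :: "('a \<times> int) list \<Rightarrow> 'a \<times> int \<Rightarrow> int" where
  "height s z = sum_list (map snd (takeWhile (\<lambda>y. y \<noteq> z) s))"

section \<open>Lists, sums and heights\<close>

lemma count_list_filter: "count_list xs x = length (filter (\<lambda>y. y = x) xs)"
  by (induction xs) auto

lemma filter_eq_distinct:
  "distinct xs \<Longrightarrow> filter (\<lambda>x. x = a) xs = (if a \<in> set xs then [a] else [])"
  by (induction xs) auto

lemma takeWhile_neq_append: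
  "a \<notin> set xs \<Longrightarrow> takeWhile (\<lambda>y. y \<noteq> a) (xs @ a # ys) = xs"
  by (induction xs) auto

lemma upt_split: "a \<le> j \<Longrightarrow> j < n \<Longrightarrow> [a..<n] = [a..<j] @ j # [Suc j..<n]"
  by (metis le_Suc_ex less_imp_le_nat upt_add_eq_append upt_conv_Cons)

lemma takeWhile_upt: "i < n \<Longrightarrow> takeWhile (\<lambda>j. j \<noteq> i) [0..<n] = [0..<i]"
  by (simp add: upt_split[of 0 i] takeWhile_neq_append)

lemma height_split: "z \<notin> set xs \<Longrightarrow> height (xs @ z # ys) z = sum_list (map snd xs)"
  by (simp add: height_def takeWhile_neq_append)

lemma height_append:
  "height (xs @ ys) z =
    (if z \<in> set xs then height xs z else sum_list (map snd xs) + height ys z)"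
  by (induction xs) (auto simp: height_def)

lemma sum_list_constant:
  fixes c :: int
  assumes "\<And>x. x \<in> set xs \<Longrightarrow> f x = c"
  shows "sum_list (map f xs) = int (length xs) * c"
  using assms by (induction xs) (simp_all add: algebra_simps)

text \<open>Blocks before the one that contains \<open>z\<close> enter only through their totals.
  Applied to the strands of a cable and to the blocks of a copy.\<close>

lemma height_concat_map:
  assumes "x \<in> set xs" and "z \<in> set (f x)"
    and "\<And>y. y \<in> set xs \<Longrightarrow> y \<noteq> x \<Longrightarrow> z \<notin> set (f y)"
  shows "height (concat (map f xs)) z =
    (\<Sum>y \<leftarrow> takeWhile (\<lambda>y. y \<noteq> x) xs. sum_list (map snd (f y))) + height (f x) z"
  using assms
proof (induction xs)
  case (Cons a xs)
  show ?case
  proof (cases "a = x")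
    case True
    then show ?thesis using Cons.prems by (simp add: height_append)
  next
    case False
    then have "height (concat (map f xs)) z =
      (\<Sum>y \<leftarrow> takeWhile (\<lambda>y. y \<noteq> x) xs. sum_list (map snd (f y))) + height (f x) z"
      using Cons.prems by (intro Cons.IH) auto
    then show ?thesis using False Cons.prems by (simp add: height_append)
  qed
qed simp

text \<open>Each entry lies in exactly one class, that of its value under \<open>g\<close>. This
  trades sums over letters for sums over occurrences.\<close>

lemma sum_list_filter_partition:
  fixes f :: "'a \<Rightarrow> int"
  assumes "finite S" and "g ` set xs \<subseteq> S"
  shows "(\<Sum>Y \<in> S. sum_list (map f (filter (\<lambda>x. g x = Y) xs))) = sum_list (map f xs)"
  using assms(2)
proof (induction xs)
  case (Cons a xs)
  have "(\<Sum>Y \<in> S. sum_list (map f (filter (\<lambda>x. g x = Y) (a # xs)))) =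
    (\<Sum>Y \<in> S. (if g a = Y then f a else 0) + sum_list (map f (filter (\<lambda>x. g x = Y) xs)))"
    by (rule sum.cong) auto
  also have "\<dots> = f a + sum_list (map f xs)"
    using Cons assms(1) by (simp add: sum.distrib sum.delta)
  finally show ?case by simp
qed simp

subsection \<open>Signed words\<close>

fun sign_from :: "letter set \<Rightarrow> (letter \<Rightarrow> letter_type) \<Rightarrow> letter list \<Rightarrow> (letter \<times> int) list" where
  "sign_from seen t [] = []"
| "sign_from seen t (X # w) =
    (X, if X \<in> seen then - type_sign (t X) else type_sign (t X)) # sign_from (insert X seen) t w"

lemma map_fst_sign_from [simp]: "map fst (sign_from seen t w) = w"
  by (induction w arbitrary: seen) auto

text \<open>Arbitrary multiplicities and an arbitrary set \<open>seen\<close> keep the induction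
  going, since the tail of a Gauss word need not be a Gauss word.\<close>

lemma filter_sign_from:
  "filter (\<lambda>z. fst z = X) (sign_from seen t w) =
    (if X \<in> seen then replicate (count_list w X) (X, - type_sign (t X))
     else case count_list w X of 0 \<Rightarrow> []
       | Suc m \<Rightarrow> (X, type_sign (t X)) # replicate m (X, - type_sign (t X)))"
  by (induction w arbitrary: seen) (auto split: nat.split)

lemma gauss_word_signed:
  assumes "gauss_word w"
  obtains s where "map fst s = w" and "signed_word t s"
proof
  have "fst ` set (sign_from {} t w) = set w"
    by (metis list.set_map map_fst_sign_from)
  then show "signed_word t (sign_from {} t w)"
    using assms by (auto simp: signed_word_def gauss_word_def filter_sign_from eval_nat_numeral)
qed simp

lemma signed_word_gauss_word:
  assumes "signed_word t s"
  shows "gauss_word (map fst s)"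
  using assms
  by (auto simp: gauss_word_def signed_word_def count_list_filter filter_map o_def)

text \<open>A condition on letters removes both entries of a letter or neither, so the entries of a
  surviving letter are unchanged.\<close>

lemma signed_word_filter:
  assumes "signed_word t s"
  shows "signed_word t (filter (\<lambda>z. P (fst z)) s)"
  unfolding signed_word_def
proof
  fix X assume X: "X \<in> fst ` set (filter (\<lambda>z. P (fst z)) s)"
  have "filter (\<lambda>z. fst z = X) (filter (\<lambda>z. P (fst z)) s) = filter (\<lambda>z. fst z = X) s"
    using X by (auto simp: filter_filter intro!: filter_cong)
  then show "filter (\<lambda>z. fst z = X) (filter (\<lambda>z. P (fst z)) s) =
      [(X, type_sign (t X)), (X, - type_sign (t X))]"
    using X assms by (auto simp: signed_word_def)
qed

lemma signed_word_split:
  assumes "signed_word t s" and "X \<in> fst ` set s"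
  obtains u v w where "s = u @ (X, type_sign (t X)) # v @ (X, - type_sign (t X)) # w"
    and "X \<notin> fst ` set u" "X \<notin> fst ` set v" "X \<notin> fst ` set w"
proof -
  have "filter (\<lambda>z. fst z = X) s = [(X, type_sign (t X)), (X, - type_sign (t X))]"
    by (rule signed_wordD[OF assms])
  then obtain u v' where 1: "s = u @ (X, type_sign (t X)) # v'"
    and u: "\<forall>z \<in> set u. fst z \<noteq> X"
    and "[(X, - type_sign (t X))] = filter (\<lambda>z. fst z = X) v'"
    unfolding filter_eq_Cons_iff by blast
  from this(3)[symmetric] obtain v w where 2: "v' = v @ (X, - type_sign (t X)) # w"
    and v: "\<forall>z \<in> set v. fst z \<noteq> X"
    and w: "[] = filter (\<lambda>z. fst z = X) w"
    unfolding filter_eq_Cons_iff by blast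
  from u v have "X \<notin> fst ` set u" "X \<notin> fst ` set v" by auto
  moreover from w[symmetric] have "X \<notin> fst ` set w" by (auto simp: filter_empty_conv)
  ultimately show ?thesis using that[of u v w] 1 2 by blast
qed

lemma sum_list_signed_word:
  assumes "signed_word t s"
  shows "sum_list (map snd s) = 0"
proof -
  have "sum_list (map snd s) =
    (\<Sum>Y \<in> fst ` set s. sum_list (map snd (filter (\<lambda>z. fst z = Y) s)))"
    by (rule sum_list_filter_partition [symmetric]) auto
  also have "\<dots> = 0"
    using assms by (intro sum.neutral) (simp add: signed_word_def)
  finally show ?thesis .
qed

text \<open>If \<open>v\<close>, the segment between the two entries of \<open>X\<close>, contains
  none or both of the entries of \<open>Y\<close>, there is no linking and the sum is 0. If it
  contains exactly one, the letters are linked, and the sign of that entry times the sign of the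
  first entry of \<open>X\<close> is the linking number.\<close>

lemma link_signed_word:
  assumes s: "s = u @ (X, type_sign (t X)) # v @ (X, - type_sign (t X)) # w"
    and X: "X \<notin> fst ` set u" "X \<notin> fst ` set v" "X \<notin> fst ` set w"
    and "signed_word t s" and "Y \<in> fst ` set s"
  shows "link (Nanoword (map fst s) t) X Y =
    type_sign (t X) * sum_list (map snd (filter (\<lambda>z. fst z = Y) v))"
proof (cases "X = Y")
  case True
  have "filter (\<lambda>z. fst z = Y) v = []" using X True by (auto simp: filter_empty_conv)
  then show ?thesis using True by (simp add: link_def alternate_def)
next
  case False
  define a b c where "a = filter (\<lambda>z. fst z = Y) u" "b = filter (\<lambda>z. fst z = Y) v"
    "c = filter (\<lambda>z. fst z = Y) w"
  note abc = this
  have pair: "a @ b @ c = [(Y, type_sign (t Y)), (Y, - type_sign (t Y))]"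
    using signed_wordD[OF assms(5,6)] False by (simp add: s abc)
  have eq: "filter (\<lambda>Z. Z = X \<or> Z = Y) (map fst x) = map fst (filter (\<lambda>z. fst z = Y) x)"
    if "X \<notin> fst ` set x" for x
    using that by (induction x) auto
  have filt: "filter (\<lambda>Z. Z = X \<or> Z = Y) (map fst s) =
      map fst a @ [X] @ map fst b @ [X] @ map fst c"
    using eq[OF X(1)] eq[OF X(2)] eq[OF X(3)] by (simp add: s abc)
  have filt': "filter (\<lambda>Z. Z = Y \<or> Z = X) (map fst s) =
      map fst a @ [X] @ map fst b @ [X] @ map fst c"
    using filt by (simp add: disj_commute)
  \<comment> \<open>The six ways to distribute the two entries of \<open>Y\<close> over the three
    segments.\<close>
  have "a = [] \<and> b = [] \<or> a = [] \<and> c = [] \<or> b = [] \<and> c = [] \<or>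
      (\<exists>y z. a = [y] \<and> b = [z] \<and> c = []) \<or> (\<exists>y z. a = [y] \<and> b = [] \<and> c = [z]) \<or>
      (\<exists>y z. a = [] \<and> b = [y] \<and> c = [z])"
    using pair by (auto simp: append_eq_Cons_conv)
  then have "link (Nanoword (map fst s) t) X Y = type_sign (t X) * sum_list (map snd b)"
    using pair False
    by (cases "t X"; cases "t Y") (auto simp: link_def alternate_def filt filt')
  then show ?thesis by (simp add: abc)
qed

text \<open>Summing over \<open>Y\<close> leaves the total of the segment \<open>v\<close>, which is
  a difference of heights minus the sign of the first entry of \<open>X\<close>. Multiplication by
  that sign turns the last term into 1 and orders the heights as negative minus positive for either
  type.\<close>

lemma link_sum_signed_word:
  assumes "signed_word t s" and "X \<in> fst ` set s"
  shows "link_sum (Nanoword (map fst s) t) X = height s (X, - 1) - height s (X, 1) - 1"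
proof -
  obtain u v w where s: "s = u @ (X, type_sign (t X)) # v @ (X, - type_sign (t X)) # w"
    and X: "X \<notin> fst ` set u" "X \<notin> fst ` set v" "X \<notin> fst ` set w"
    using signed_word_split[OF assms] .
  have "link_sum (Nanoword (map fst s) t) X = (\<Sum>Y \<in> fst ` set s.
      type_sign (t X) * sum_list (map snd (filter (\<lambda>z. fst z = Y) v)))"
    unfolding link_sum_def by (rule sum.cong) (auto intro: link_signed_word[OF s X assms(1)])
  also have "\<dots> = type_sign (t X) * sum_list (map snd v)"
    unfolding sum_distrib_left[symmetric]
    by (subst sum_list_filter_partition) (auto simp: s)
  also have "\<dots> = height s (X, - 1) - height s (X, 1) - 1"
  proof -
    have *: "(X, e) \<notin> set u" "(X, e) \<notin> set v" for e using X by force+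
    have 1: "height s (X, type_sign (t X)) = sum_list (map snd u)"
      unfolding s using * by (intro height_split) auto
    have "height ((u @ (X, type_sign (t X)) # v) @ (X, - type_sign (t X)) # w)
        (X, - type_sign (t X)) = sum_list (map snd (u @ (X, type_sign (t X)) # v))"
      using * by (intro height_split) auto
    then have 2: "height s (X, - type_sign (t X)) =
        sum_list (map snd u) + type_sign (t X) + sum_list (map snd v)"
      by (simp add: s)
    from 1 2 show ?thesis by (cases "t X") simp_all
  qed
  finally show ?thesis .
qed

subsection \<open>The cable of a signed word\<close>

text \<open>Whether an occurrence is the first is read off its sign, so a block depends on the entry
  alone and not on its position. Its letters inherit the sign;
  \<open>signed_word_signed_cable\<close> shows that this agrees with
  \<open>cable_type\<close>.\<close>

definition signed_block ::
  "nat \<Rightarrow> (letter \<Rightarrow> letter_type) \<Rightarrow> nat \<Rightarrow> letter \<times> int \<Rightarrow> (letter \<times> int) list" where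
  "signed_block n t i z = map (\<lambda>B. (B, snd z))
    (if snd z = type_sign (t (fst z)) then first_block n (t (fst z)) i (fst z)
     else second_block n (t (fst z)) i (fst z))"

definition signed_copy ::
  "nat \<Rightarrow> (letter \<Rightarrow> letter_type) \<Rightarrow> (letter \<times> int) list \<Rightarrow> nat \<Rightarrow> (letter \<times> int) list" where
  "signed_copy n t s i = concat (map (signed_block n t i) s)"

text \<open>The joining letter is attached to its copy, with none for the last, so that the cable is
  a uniform concatenation over all copies followed by the negative occurrences of the joining
  letters.\<close>

definition signed_strand ::
  "nat \<Rightarrow> (letter \<Rightarrow> letter_type) \<Rightarrow> (letter \<times> int) list \<Rightarrow> nat \<Rightarrow> (letter \<times> int) list" where
  "signed_strand n t s i = signed_copy n t s i @ (if Suc i < n then [(Joining i, 1)] else [])"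

definition signed_cable ::
  "nat \<Rightarrow> (letter \<Rightarrow> letter_type) \<Rightarrow> (letter \<times> int) list \<Rightarrow> (letter \<times> int) list" where
  "signed_cable n t s = concat (map (signed_strand n t s) [0..<n])
    @ map (\<lambda>i. (Joining i, - 1)) (rev [0..<n - 1])"

text \<open>Of the two entries of a letter, the one with the sign of its type comes first. This
  turns the positional test in \<open>parallel_copy\<close> into the test on signs in
  \<open>signed_block\<close>.\<close>

lemma first_occurrence_iff_sign:
  assumes "signed_word t s" and "p < length s"
  shows "fst (s ! p) \<notin> set (take p (map fst s)) \<longleftrightarrow> snd (s ! p) = type_sign (t (fst (s ! p)))"
proof -
  define X where "X = fst (s ! p)"
  have "filter (\<lambda>z. fst z = X) (take p s @ s ! p # drop (Suc p) s) =
      [(X, type_sign (t X)), (X, - type_sign (t X))]"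
    using assms by (simp add: id_take_nth_drop[symmetric] signed_word_def X_def)
  then have *: "filter (\<lambda>z. fst z = X) (take p s) @ s ! p # filter (\<lambda>z. fst z = X) (drop (Suc p) s) =
      [(X, type_sign (t X)), (X, - type_sign (t X))]"
    by (simp add: X_def)
  have "X \<notin> set (take p (map fst s)) \<longleftrightarrow> filter (\<lambda>z. fst z = X) (take p s) = []"
    by (auto simp: take_map filter_empty_conv)
  also have "\<dots> \<longleftrightarrow> snd (s ! p) = type_sign (t X)"
    using * by (auto simp: append_eq_Cons_conv)
  finally show ?thesis by (simp add: X_def)
qed

lemma parallel_copy_signed:
  assumes "signed_word t s"
  shows "parallel_copy n (Nanoword (map fst s) t) i = map fst (signed_copy n t s i)"
proof -
  have "(let A = map fst s ! p in
      if A \<notin> set (take p (map fst s)) then first_block n (ltype (Nanoword (map fst s) t) A) i A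
      else second_block n (ltype (Nanoword (map fst s) t) A) i A) =
      map fst (signed_block n t i (s ! p))"
    if "p < length s" for p
    using first_occurrence_iff_sign[OF assms that] that
    by (simp add: Let_def signed_block_def o_def)
  then have "parallel_copy n (Nanoword (map fst s) t) i =
      concat (map (\<lambda>p. map fst (signed_block n t i (s ! p))) [0..<length s])"
    unfolding parallel_copy_def by (auto intro!: arg_cong[where f = concat] map_cong)
  also have "\<dots> = concat (map (\<lambda>z. map fst (signed_block n t i z)) (map ((!) s) [0..<length s]))"
    by (simp add: o_def)
  also have "\<dots> = map fst (signed_copy n t s i)"
    by (simp only: map_nth) (simp add: signed_copy_def map_concat o_def)
  finally show ?thesis .
qed

lemma cable_signed:
  assumes "signed_word t s" and "n \<ge> 1"
  shows "cable n (Nanoword (map fst s) t) =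
    Nanoword (map fst (signed_cable n t s)) (cable_type n t)"
proof -
  \<comment> \<open>Splits off the last copy, the only one without a joining letter.\<close>
  obtain m where n: "n = Suc m" using assms(2) by (cases n) auto
  have "concat (map (\<lambda>i. parallel_copy n (Nanoword (map fst s) t) i @ [Joining i]) [0..<m]) =
      concat (map (\<lambda>i. map fst (signed_strand n t s i)) [0..<m])"
    using parallel_copy_signed[OF assms(1)]
    by (intro arg_cong[where f = concat] map_cong) (auto simp: signed_strand_def n)
  then show ?thesis
    using parallel_copy_signed[OF assms(1)]
    by (simp add: cable_def signed_cable_def n map_concat o_def signed_strand_def)
qed

text \<open>For a crossing \<open>Crossing A p q\<close>, the number of the parallel copy that contains its
  occurrence of sign e, and the offset of this occurrence in its block.\<close>

definition copy_index :: "nat \<Rightarrow> letter_type \<Rightarrow> int \<Rightarrow> nat \<Rightarrow> nat \<Rightarrow> nat" where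
  "copy_index n T e p q = (if T = Type_a then if e = 1 then p else q
    else if e = - 1 then q else (p + n - 1) mod n)"

definition block_offset :: "nat \<Rightarrow> letter_type \<Rightarrow> int \<Rightarrow> nat \<Rightarrow> nat \<Rightarrow> nat" where
  "block_offset n T e p q = (if T = Type_a then if e = 1 then q else n - Suc p
    else if e = - 1 then if p = 0 then 0 else n - p else q)"

lemma copy_index_less: "p < n \<Longrightarrow> q < n \<Longrightarrow> copy_index n T e p q < n"
  by (auto simp: copy_index_def)

text \<open>Predecessor and successor modulo \<open>n\<close> are inverse to each other. In type b
  the second block of copy \<open>i\<close> has first index \<open>i + 1\<close>, so
  \<open>copy_index\<close> recovers the copy as \<open>p - 1\<close> modulo
  \<open>n\<close>.\<close>

lemma pred_mod_eq_iff:
  fixes p n i :: nat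
  assumes "p < n" and "i < n"
  shows "(p + n - 1) mod n = i \<longleftrightarrow> (i + 1) mod n = p"
proof (cases p)
  case 0
  then show ?thesis using assms by (cases "Suc i = n") auto
next
  case (Suc m)
  then have "(p + n - 1) mod n = m" using assms by simp
  then show ?thesis using Suc assms by (cases "Suc i = n") auto
qed

text \<open>A block runs once through all values of one index with the other fixed, so the crossing
  occurs in it exactly once.\<close>

lemma block_split:
  assumes "i < n" "p < n" "q < n" "copy_index n (t A) e p q = i"
  obtains xs ys where "signed_block n t i (A, e) = xs @ (Crossing A p q, e) # ys"
    and "\<And>x. x \<in> set xs \<union> set ys \<Longrightarrow> fst x \<noteq> Crossing A p q"
    and "length xs = block_offset n (t A) e p q"
    and "\<And>x. x \<in> set xs \<Longrightarrow> snd x = e"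
proof -
  have rev_upt: "rev [a..<n] = rev [Suc j..<n] @ j # rev [a..<j]" if "a \<le> j" "j < n" for a j :: nat
    using that by (simp add: upt_split[OF that])
  \<comment> \<open>As in \<open>signed_block\<close>, any \<open>e\<close> other than the sign of a
    first occurrence counts as a second one. The first block of type b lists index 0 and then
    \<open>n - 1\<close> down to 1, hence the separate case \<open>p = 0\<close>.\<close>
  consider "t A = Type_a" "e = 1" | "t A = Type_a" "e \<noteq> 1"
    | "t A = Type_b" "e = - 1" "p = 0" | "t A = Type_b" "e = - 1" "p > 0"
    | "t A = Type_b" "e \<noteq> - 1"
    by (cases "t A") auto
  then show ?thesis
  proof cases
    case 1
    show ?thesis
      by (rule that[of "map (\<lambda>j. (Crossing A p j, e)) [0..<q]"
            "map (\<lambda>j. (Crossing A p j, e)) [Suc q..<n]"])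
        (use 1 assms upt_split[of 0 q n] in
          \<open>auto simp: signed_block_def copy_index_def block_offset_def o_def\<close>)
  next
    case 2
    show ?thesis
      by (rule that[of "map (\<lambda>j. (Crossing A j q, e)) (rev [Suc p..<n])"
            "map (\<lambda>j. (Crossing A j q, e)) (rev [0..<p])"])
        (use 2 assms rev_upt[of 0 p] in
          \<open>auto simp: signed_block_def copy_index_def block_offset_def o_def\<close>)
  next
    case 3
    show ?thesis
      by (rule that[of "[]" "map (\<lambda>j. (Crossing A j q, e)) (rev [1..<n])"])
        (use 3 assms in
          \<open>auto simp: signed_block_def copy_index_def block_offset_def o_def\<close>)
  next
    case 4
    show ?thesis
      by (rule that[of "(Crossing A 0 q, e) # map (\<lambda>j. (Crossing A j q, e)) (rev [Suc p..<n])"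
            "map (\<lambda>j. (Crossing A j q, e)) (rev [1..<p])"])
        (use 4 assms rev_upt[of 1 p] in
          \<open>auto simp: signed_block_def copy_index_def block_offset_def o_def\<close>)
  next
    case 5
    show ?thesis
      by (rule that[of "map (\<lambda>j. (Crossing A p j, e)) [0..<q]"
            "map (\<lambda>j. (Crossing A p j, e)) [Suc q..<n]"])
        (use 5 assms upt_split[of 0 q n] pred_mod_eq_iff[of p n i] in
          \<open>auto simp: signed_block_def copy_index_def block_offset_def o_def\<close>)
  qed
qed

lemma set_signed_block:
  assumes "i < n"
  shows "set (signed_block n t i (A, e)) =
    {(Crossing A p q, e) | p q. p < n \<and> q < n \<and> copy_index n (t A) e p q = i}"
proof -
  have "p < n \<and> q < n \<and> copy_index n Type_b e p q = i \<longleftrightarrow> p = (i + 1) mod n \<and> q < n"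
    if "e \<noteq> - 1" for p q
    using that assms pred_mod_eq_iff[of p n i] by (auto simp: copy_index_def)
  then show ?thesis
    using assms
    by (cases "t A"; cases "e = type_sign (t A)")
      (auto simp: signed_block_def copy_index_def image_iff)
qed

lemma filter_signed_block:
  assumes "i < n" "p < n" "q < n"
  shows "filter (\<lambda>y. fst y = Crossing A p q) (signed_block n t i z) =
    (if fst z = A \<and> copy_index n (t A) (snd z) p q = i then [(Crossing A p q, snd z)] else [])"
proof (cases "fst z = A \<and> copy_index n (t A) (snd z) p q = i")
  case True
  then obtain xs ys where "signed_block n t i (A, snd z) = xs @ (Crossing A p q, snd z) # ys"
    "\<And>x. x \<in> set xs \<union> set ys \<Longrightarrow> fst x \<noteq> Crossing A p q"
    using block_split[OF assms] by metis
  moreover from this have "filter (\<lambda>y. fst y = Crossing A p q) xs = []"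
    "filter (\<lambda>y. fst y = Crossing A p q) ys = []"
    by (auto simp: filter_empty_conv)
  ultimately show ?thesis using True by (cases z) auto
next
  case False
  then show ?thesis
    using set_signed_block[OF assms(1), of t "fst z" "snd z"]
    by (auto simp: filter_empty_conv)
qed

lemma length_signed_block:
  assumes "n \<ge> 1"
  shows "length (signed_block n t i z) = n"
  using assms by (cases "t (fst z)") (simp_all add: signed_block_def)

lemma sum_list_signed_block:
  assumes "n \<ge> 1"
  shows "sum_list (map snd (signed_block n t i z)) = int n * snd z"
proof -
  have "snd y = snd z" if "y \<in> set (signed_block n t i z)" for y
    using that by (auto simp: signed_block_def)
  then show ?thesis
    by (subst sum_list_constant[where c = "snd z"]) (auto simp: length_signed_block[OF assms])
qed

lemma sum_list_signed_copy:
  assumes "n \<ge> 1"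
  shows "sum_list (map snd (signed_copy n t s i)) = int n * sum_list (map snd s)"
  by (induction s) (simp_all add: signed_copy_def sum_list_signed_block[OF assms] distrib_left)

lemma set_signed_copy:
  assumes "i < n"
  shows "set (signed_copy n t s i) = {(Crossing A p q, e) | A e p q.
    (A, e) \<in> set s \<and> p < n \<and> q < n \<and> copy_index n (t A) e p q = i}"
proof -
  have "set (signed_copy n t s i) = (\<Union>(A, e) \<in> set s. set (signed_block n t i (A, e)))"
    by (auto simp: signed_copy_def)
  then show ?thesis by (auto simp: set_signed_block[OF assms])
qed

text \<open>A copy keeps the order of the entries of \<open>A\<close>. If both entries of a crossing
  fall into the same copy, the one with sign \<open>\<sigma>\<close> therefore comes first.\<close>

lemma filter_crossing_signed_copy:
  assumes "signed_word t s" and "A \<in> fst ` set s" and "i < n" "p < n" "q < n"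
  defines "\<sigma> \<equiv> type_sign (t A)"
  shows "filter (\<lambda>y. fst y = Crossing A p q) (signed_copy n t s i) =
    (if copy_index n (t A) \<sigma> p q = i then [(Crossing A p q, \<sigma>)] else []) @
    (if copy_index n (t A) (- \<sigma>) p q = i then [(Crossing A p q, - \<sigma>)] else [])"
proof -
  have "filter (\<lambda>y. fst y = Crossing A p q) (signed_copy n t xs i) =
      concat (map (\<lambda>z. if copy_index n (t A) (snd z) p q = i
        then [(Crossing A p q, snd z)] else []) (filter (\<lambda>z. fst z = A) xs))" for xs
    by (induction xs) (simp_all add: signed_copy_def filter_signed_block[OF assms(3-5)])
  moreover have "filter (\<lambda>z. fst z = A) s = [(A, \<sigma>), (A, - \<sigma>)]"
    unfolding \<sigma>_def by (rule signed_wordD[OF assms(1,2)])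
  ultimately show ?thesis by simp
qed

text \<open>Reads off the order of two entries from the numbers \<open>a\<close> and
  \<open>b\<close> of their copies. A tie puts \<open>x\<close> first, and a number that is at least
  \<open>n\<close> means that the entry is absent.\<close>

lemma concat_map_two:
  "concat (map (\<lambda>i. (if a = i then [x] else []) @ (if b = i then [y] else [])) [0..<n]) =
    (if a < n then if b < n then if a \<le> b then [x, y] else [y, x] else [x]
     else if b < n then [y] else [])"
  by (induction n) auto

lemma fst_set_signed_cable:
  assumes "X \<in> fst ` set (signed_cable n t s)"
  obtains A p q where "X = Crossing A p q" "A \<in> fst ` set s" "p < n" "q < n"
  | i where "X = Joining i" "i < n - 1"
proof -
  have "(\<exists>A p q. X = Crossing A p q \<and> A \<in> fst ` set s \<and> p < n \<and> q < n)
    \<or> (\<exists>i. X = Joining i \<and> i < n - 1)"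
    using assms
    by (auto simp: signed_cable_def signed_strand_def set_signed_copy image_iff
          split: if_splits) force+
  then show ?thesis using that by blast
qed

lemma filter_joining_signed_copy:
  assumes "i < n"
  shows "filter (\<lambda>y. fst y = Joining j) (signed_copy n t s i) = []"
  by (auto simp: filter_empty_conv set_signed_copy[OF assms])

text \<open>The entry with the sign of the first occurrence of \<open>A\<close> comes first iff its
  copy number is at most that of the other entry. This comparison is \<open>p \<le> q\<close> in
  type a and \<open>q \<le> (p + n - 1) mod n\<close> in type b, as in \<open>cable_type\<close>. A
  joining letter is positive at the end of its strand and negative in the final arc.\<close>

lemma signed_word_signed_cable:
  assumes s: "signed_word t s"
  shows "signed_word (cable_type n t) (signed_cable n t s)"
  unfolding signed_word_def
proof
  fix X assume "X \<in> fst ` set (signed_cable n t s)"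
  then show "filter (\<lambda>z. fst z = X) (signed_cable n t s) =
    [(X, type_sign (cable_type n t X)), (X, - type_sign (cable_type n t X))]"
  proof (cases rule: fst_set_signed_cable)
    case (1 A p q)
    let ?\<sigma> = "type_sign (t A)"
    have "filter (\<lambda>z. fst z = X) (signed_strand n t s i) =
      (if copy_index n (t A) ?\<sigma> p q = i then [(X, ?\<sigma>)] else []) @
      (if copy_index n (t A) (- ?\<sigma>) p q = i then [(X, - ?\<sigma>)] else [])" if "i < n" for i
      using filter_crossing_signed_copy[OF s 1(2) that 1(3,4)]
      by (simp add: 1(1) signed_strand_def)
    then have "concat (map (\<lambda>i. filter (\<lambda>z. fst z = X) (signed_strand n t s i)) [0..<n]) =
      concat (map (\<lambda>i. (if copy_index n (t A) ?\<sigma> p q = i then [(X, ?\<sigma>)] else []) @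
        (if copy_index n (t A) (- ?\<sigma>) p q = i then [(X, - ?\<sigma>)] else [])) [0..<n])"
      by (intro arg_cong[where f = concat] map_cong) auto
    also have "\<dots> = (if copy_index n (t A) ?\<sigma> p q \<le> copy_index n (t A) (- ?\<sigma>) p q
        then [(X, ?\<sigma>), (X, - ?\<sigma>)] else [(X, - ?\<sigma>), (X, ?\<sigma>)])"
      using copy_index_less[OF 1(3,4)] by (subst concat_map_two) simp
    also have "\<dots> = [(X, type_sign (cable_type n t X)), (X, - type_sign (cable_type n t X))]"
      by (cases "t A") (auto simp: 1(1) copy_index_def)
    finally have "concat (map (\<lambda>i. filter (\<lambda>z. fst z = X) (signed_strand n t s i)) [0..<n]) = \<dots>" .
    moreover have "filter (\<lambda>z. fst z = X) (map (\<lambda>i. (Joining i, - 1)) (rev [0..<n - 1])) = []"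
      by (auto simp: filter_empty_conv 1(1))
    ultimately show ?thesis by (simp add: signed_cable_def filter_concat o_def)
  next
    case (2 j)
    \<comment> \<open>The value \<open>n\<close> is out of range, so the second entry never
      appears.\<close>
    have "concat (map (\<lambda>i. filter (\<lambda>z. fst z = X) (signed_strand n t s i)) [0..<n]) =
      concat (map (\<lambda>i. (if j = i then [(X, 1)] else []) @ (if n = i then [(X, 1)] else [])) [0..<n])"
      using 2 filter_joining_signed_copy
      by (intro arg_cong[where f = concat] map_cong) (auto simp: signed_strand_def)
    also have "\<dots> = [(X, 1)]" using 2 by (subst concat_map_two) auto
    finally have "concat (map (\<lambda>i. filter (\<lambda>z. fst z = X) (signed_strand n t s i)) [0..<n]) = [(X, 1)]" .
    moreover have "filter (\<lambda>z. fst z = X) (map (\<lambda>i. (Joining i, - 1)) (rev [0..<n - 1])) =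
      [(X, - 1)]"
      using 2 filter_eq_distinct[of "rev [0..<n - 1]" j] by (simp add: filter_map o_def)
    ultimately show ?thesis by (simp add: signed_cable_def filter_concat o_def 2(1))
  qed
qed

subsection \<open>Linking numbers in a cable\<close>

text \<open>Each of the \<open>i\<close> earlier strands has total 1: its copy sums to 0, and it
  ends in a positive joining letter.\<close>

lemma height_signed_strands:
  assumes s: "signed_word t s" and "i < n" and "z \<in> set (signed_strand n t s i)"
    and "\<And>j. j < n \<Longrightarrow> j \<noteq> i \<Longrightarrow> z \<notin> set (signed_strand n t s j)"
  shows "height (signed_cable n t s) z = int i + height (signed_strand n t s i) z"
proof -
  have "sum_list (map snd (signed_strand n t s j)) = 1" if "j < i" for j
    using that assms(2) sum_list_signed_copy[of n t s j]
    by (simp add: signed_strand_def sum_list_signed_word[OF s])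
  then have "(\<Sum>j \<leftarrow> [0..<i]. sum_list (map snd (signed_strand n t s j))) = int i"
    by (subst sum_list_constant[where c = 1]) auto
  moreover have "height (concat (map (signed_strand n t s) [0..<n])) z =
      (\<Sum>j \<leftarrow> takeWhile (\<lambda>j. j \<noteq> i) [0..<n]. sum_list (map snd (signed_strand n t s j)))
        + height (signed_strand n t s i) z"
    using assms(2-4) by (intro height_concat_map) auto
  moreover have "z \<in> set (concat (map (signed_strand n t s) [0..<n]))"
    using assms(2,3) by auto
  ultimately show ?thesis
    using assms(2) by (simp add: signed_cable_def height_append takeWhile_upt)
qed

lemma signed_word_memI:
  assumes "signed_word t s" and "A \<in> fst ` set s" and "e = 1 \<or> e = - 1"
  shows "(A, e) \<in> set s"
proof -
  have "set (filter (\<lambda>z. fst z = A) s) = {(A, type_sign (t A)), (A, - type_sign (t A))}"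
    by (simp only: signed_wordD[OF assms(1,2)]) simp
  then show ?thesis using assms(3) by (cases "t A") auto
qed

text \<open>The three terms come from the earlier strands, from the earlier blocks of the same copy,
  each of \<open>n\<close> equal signs, and from the earlier letters of the same block.\<close>

lemma height_signed_cable_crossing:
  assumes s: "signed_word t s" and "(A, e) \<in> set s" and "p < n" "q < n"
  shows "height (signed_cable n t s) (Crossing A p q, e) =
    int (copy_index n (t A) e p q) + int n * height s (A, e) + e * int (block_offset n (t A) e p q)"
proof -
  define i where "i = copy_index n (t A) e p q"
  have i: "i < n" using assms copy_index_less by (simp add: i_def)
  let ?z = "(Crossing A p q, e)"
  have mem: "?z \<in> set (signed_copy n t s j) \<longleftrightarrow> j = i" if "j < n" for j
    using assms(2-4) that by (auto simp: set_signed_copy i_def)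
  obtain xs ys where block: "signed_block n t i (A, e) = xs @ ?z # ys"
    and xs: "\<And>x. x \<in> set xs \<union> set ys \<Longrightarrow> fst x \<noteq> Crossing A p q"
    and len: "length xs = block_offset n (t A) e p q"
    and snd: "\<And>x. x \<in> set xs \<Longrightarrow> snd x = e"
    using block_split[where t = t and A = A and e = e, OF i assms(3,4) i_def[symmetric]] by metis
  have "sum_list (map snd xs) = e * int (block_offset n (t A) e p q)"
    using snd by (subst sum_list_constant[where c = e]) (auto simp: len)
  then have "height (signed_block n t i (A, e)) ?z = e * int (block_offset n (t A) e p q)"
    using xs by (subst block, subst height_split) fastforce+
  moreover have "height (signed_copy n t s i) ?z =
      (\<Sum>y \<leftarrow> takeWhile (\<lambda>y. y \<noteq> (A, e)) s. sum_list (map snd (signed_block n t i y)))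
        + height (signed_block n t i (A, e)) ?z"
    unfolding signed_copy_def
  proof (rule height_concat_map)
    show "?z \<notin> set (signed_block n t i y)" if "y \<noteq> (A, e)" for y
      using that by (cases y) (auto simp: set_signed_block[OF i])
  qed (use assms(2) block in auto)
  moreover have "(\<Sum>y \<leftarrow> xs. sum_list (map snd (signed_block n t i y))) =
      int n * sum_list (map snd xs)" for xs
    using i by (simp add: sum_list_signed_block sum_list_const_mult)
  ultimately have "height (signed_copy n t s i) ?z =
      int n * height s (A, e) + e * int (block_offset n (t A) e p q)"
    by (simp add: height_def)
  moreover have "height (signed_strand n t s i) ?z = height (signed_copy n t s i) ?z"
    using mem[OF i] by (simp add: signed_strand_def height_append)
  moreover have "height (signed_cable n t s) ?z = int i + height (signed_strand n t s i) ?z"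
    using mem i by (intro height_signed_strands[OF s]) (auto simp: signed_strand_def)
  ultimately show ?thesis by (simp add: i_def)
qed

lemma link_sum_crossing:
  assumes s: "signed_word t s" and A: "A \<in> fst ` set s" and pq: "p < n" "q < n"
  shows "link_sum (Nanoword (map fst (signed_cable n t s)) (cable_type n t)) (Crossing A p q) =
    int n * link_sum (Nanoword (map fst s) t) A"
proof -
  have mem: "(A, 1) \<in> set s" "(A, - 1) \<in> set s" using signed_word_memI[OF s A] by auto
  have "(Crossing A p q, 1) \<in> set (signed_copy n t s (copy_index n (t A) 1 p q))"
    using mem pq copy_index_less[OF pq] by (auto simp: set_signed_copy)
  then have "(Crossing A p q, 1) \<in> set (signed_cable n t s)"
    using copy_index_less[OF pq] by (force simp: signed_cable_def signed_strand_def)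
  then have X: "Crossing A p q \<in> fst ` set (signed_cable n t s)" by force
  \<comment> \<open>Copy numbers and offsets contribute \<open>1 - n\<close> for all
    \<open>p\<close>, \<open>q\<close> and both types. With the -1 of the height formula this is
    \<open>- n\<close>, which is \<open>n\<close> times the -1 in the formula for
    \<open>A\<close>.\<close>
  have "int (copy_index n (t A) (- 1) p q) - int (block_offset n (t A) (- 1) p q)
      - int (copy_index n (t A) 1 p q) - int (block_offset n (t A) 1 p q) - 1 = - int n"
  proof (cases "t A = Type_a")
    case True
    then show ?thesis using pq by (simp add: copy_index_def block_offset_def of_nat_diff)
  next
    case False
    show ?thesis
    proof (cases p)
      case 0
      then show ?thesis using pq False
        by (simp add: copy_index_def block_offset_def of_nat_diff)
    next
      case (Suc m)
      then have "(p + n - 1) mod n = m" using pq by simp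
      then show ?thesis using pq False Suc
        by (simp add: copy_index_def block_offset_def of_nat_diff)
    qed
  qed
  then show ?thesis
    unfolding link_sum_signed_word[OF signed_word_signed_cable[OF s] X]
      link_sum_signed_word[OF s A] height_signed_cable_crossing[OF s mem(1) pq]
      height_signed_cable_crossing[OF s mem(2) pq]
    by (simp add: algebra_simps)
qed

text \<open>The positive entry has height \<open>i\<close>, from the strands before it. The negative
  one follows all strands, of total \<open>n - 1\<close>, and the \<open>n - 2 - i\<close> negative
  letters of larger index, so its height is \<open>i + 1\<close>.\<close>

lemma link_sum_joining:
  assumes s: "signed_word t s" and i: "i < n - 1"
  shows "link_sum (Nanoword (map fst (signed_cable n t s)) (cable_type n t)) (Joining i) = 0"
proof -
  have "n \<ge> 1" using i by simp
  have nocopy: "(Joining i, e) \<notin> set (signed_copy n t s j)" if "j < n" for e j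
    by (auto simp: set_signed_copy[OF that])
  have X: "Joining i \<in> fst ` set (signed_cable n t s)"
    using i by (force simp: signed_cable_def)
  have "height (signed_cable n t s) (Joining i, 1) =
      int i + height (signed_strand n t s i) (Joining i, 1)"
    using i nocopy by (intro height_signed_strands[OF s]) (auto simp: signed_strand_def)
  also have "height (signed_strand n t s i) (Joining i, 1) = 0"
    using i nocopy[of i 1] \<open>n \<ge> 1\<close>
    by (simp add: signed_strand_def height_append sum_list_signed_copy sum_list_signed_word[OF s])
      (simp add: height_def)
  finally have pos: "height (signed_cable n t s) (Joining i, 1) = int i" by simp
  \<comment> \<open>The minimum accounts for the last strand, whose total is 0. The claim is made
    for all prefixes to allow induction.\<close>
  have strands: "sum_list (map snd (concat (map (signed_strand n t s) [0..<m]))) =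
      int (min m (n - 1))" if "m \<le> n" for m
    using that \<open>n \<ge> 1\<close>
    by (induction m)
      (auto simp: signed_strand_def sum_list_signed_copy sum_list_signed_word[OF s])
  have split: "rev [0..<n - 1] = rev [Suc i..<n - 1] @ i # rev [0..<i]"
    using i by (simp add: upt_split[of 0 i])
  have "height (map (\<lambda>i. (Joining i, - 1)) (rev [0..<n - 1])) (Joining i, - 1) =
      sum_list (map snd (map (\<lambda>i. (Joining i, - 1)) (rev [Suc i..<n - 1])))"
    unfolding split map_append list.map by (rule height_split) auto
  also have "\<dots> = - int (n - 1 - Suc i)"
    by (simp add: o_def sum_list_triv)
  finally have "height (signed_cable n t s) (Joining i, - 1) =
      int (n - 1) - int (n - 1 - Suc i)"
    using strands[of n] nocopy
    by (auto simp: signed_cable_def height_append signed_strand_def)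
  then have neg: "height (signed_cable n t s) (Joining i, - 1) = int i + 1"
    using i by (simp add: of_nat_diff)
  show ?thesis
    by (simp add: link_sum_signed_word[OF signed_word_signed_cable[OF s] X] pos neg)
qed

section \<open>Coverings of cables\<close>

text \<open>Each block survives or vanishes as a whole, and a surviving block is unchanged because
  it depends on its own entry only. Hence deletion commutes with cabling.\<close>

lemma filter_signed_cable:
  assumes cross: "\<And>A p q. A \<in> fst ` set s \<Longrightarrow> p < n \<Longrightarrow> q < n \<Longrightarrow> Q (Crossing A p q) \<longleftrightarrow> P A"
    and join: "\<And>i. i < n - 1 \<Longrightarrow> Q (Joining i)"
  shows "filter (\<lambda>z. Q (fst z)) (signed_cable n t s) =
    signed_cable n t (filter (\<lambda>z. P (fst z)) s)"
proof -
  have block: "filter (\<lambda>z. Q (fst z)) (signed_block n t i z) =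
      (if P (fst z) then signed_block n t i z else [])" if "z \<in> set s" "i < n" for i z
  proof -
    have "Q (fst y) \<longleftrightarrow> P (fst z)" if "y \<in> set (signed_block n t i z)" for y
      using that \<open>z \<in> set s\<close> set_signed_block[OF \<open>i < n\<close>, of t "fst z" "snd z"] cross by auto
    then show ?thesis by (auto simp: filter_empty_conv filter_id_conv)
  qed
  have copy: "filter (\<lambda>z. Q (fst z)) (signed_copy n t s' i) =
      signed_copy n t (filter (\<lambda>z. P (fst z)) s') i" if "set s' \<subseteq> set s" "i < n" for s' i
    using that by (induction s') (auto simp: signed_copy_def block)
  have "filter (\<lambda>z. Q (fst z)) (signed_strand n t s i) =
      signed_strand n t (filter (\<lambda>z. P (fst z)) s) i" if "i < n" for i
    using copy[OF subset_refl that] join[of i] by (simp add: signed_strand_def)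
  then have "concat (map (\<lambda>i. filter (\<lambda>z. Q (fst z)) (signed_strand n t s i)) [0..<n]) =
      concat (map (signed_strand n t (filter (\<lambda>z. P (fst z)) s)) [0..<n])"
    by (intro arg_cong[where f = concat] map_cong) auto
  moreover have "filter (\<lambda>z. Q (fst z)) (map (\<lambda>i. (Joining i, - 1)) (rev [0..<n - 1])) =
      map (\<lambda>i. (Joining i, - 1)) (rev [0..<n - 1])"
    using join by (auto simp: filter_id_conv)
  ultimately show ?thesis by (simp add: signed_cable_def filter_concat o_def)
qed

text \<open>After cancellation of the gcd, the cofactor \<open>k\<close> of \<open>r\<close> is
  coprime to that of \<open>n\<close>. For \<open>r = 0\<close> both sides say that \<open>m\<close>
  is 0, since \<open>n\<close> is positive.\<close>

lemma dvd_mult_iff_div_gcd: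
  assumes "n \<ge> 1" and "k = (if r = 0 then 0 else r div gcd n r)"
  shows "int r dvd int n * m \<longleftrightarrow> int k dvd m"
proof (cases "r = 0")
  case True
  then show ?thesis using assms by simp
next
  case False
  define g where "g = gcd n r"
  have g: "g > 0" using False by (simp add: g_def)
  then have "gcd n r \<noteq> 0" by (simp add: g_def)
  then obtain n' r' where n': "n = n' * g" and r': "r = r' * g" and "coprime n' r'"
    unfolding g_def by (meson gcd_coprime_exists)
  have "k = r div g" using False assms(2) by (simp add: g_def)
  then have "k = r'" using g r' by simp
  moreover have "coprime (int r') (int n')"
    using \<open>coprime n' r'\<close> by (simp add: coprime_commute)
  moreover have "int n * m = int g * (int n' * m)" "int r = int g * int r'"
    by (simp_all add: n' r')
  ultimately show ?thesis
    using g by (simp only: dvd_mult_cancel_left) (simp add: coprime_dvd_mult_right_iff)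
qed

text \<open>\<open>covering\<close> leaves the type map alone, so both sides carry the same total
  map and only the words have to be compared.\<close>

lemma cable_covering:
  assumes \<alpha>: "is_nanoword \<alpha>" and n: "n \<ge> 1"
    and k: "k = (if r = 0 then 0 else r div gcd n r)"
  shows "cable n (covering k \<alpha>) = covering r (cable n \<alpha>)"
    and "is_nanoword (cable n (covering k \<alpha>))"
proof -
  define t where "t = ltype \<alpha>"
  obtain s where w: "map fst s = word \<alpha>" and s: "signed_word t s"
    using gauss_word_signed \<alpha> is_nanoword_def by metis
  have \<alpha>: "\<alpha> = Nanoword (map fst s) t" by (simp add: w t_def)
  define P where "P X \<longleftrightarrow> int k dvd link_sum \<alpha> X" for X
  define s' where "s' = filter (\<lambda>z. P (fst z)) s"
  have s': "signed_word t s'" unfolding s'_def by (rule signed_word_filter[OF s])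
  have "covering k \<alpha> = Nanoword (map fst s') t"
    by (simp add: covering_def s'_def P_def filter_map o_def flip: w t_def)
  then have cov: "cable n (covering k \<alpha>) =
      Nanoword (map fst (signed_cable n t s')) (cable_type n t)"
    using cable_signed[OF s' n] by simp
  have cab: "cable n \<alpha> = Nanoword (map fst (signed_cable n t s)) (cable_type n t)"
    using cable_signed[OF s n] \<alpha> by simp
  have "filter (\<lambda>z. int r dvd link_sum (cable n \<alpha>) (fst z)) (signed_cable n t s) =
      signed_cable n t s'"
    unfolding s'_def
  proof (rule filter_signed_cable)
    show "int r dvd link_sum (cable n \<alpha>) (Crossing A p q) \<longleftrightarrow> P A"
      if "A \<in> fst ` set s" "p < n" "q < n" for A p q
      by (simp add: P_def link_sum_crossing[OF s that, folded \<alpha> cab]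
          dvd_mult_iff_div_gcd[OF n k])
    show "int r dvd link_sum (cable n \<alpha>) (Joining i)" if "i < n - 1" for i
      using link_sum_joining[OF s that] by (simp add: cab)
  qed
  then show "cable n (covering k \<alpha>) = covering r (cable n \<alpha>)"
    unfolding cov by (simp add: covering_def cab filter_map o_def)
  show "is_nanoword (cable n (covering k \<alpha>))"
    using signed_word_gauss_word[OF signed_word_signed_cable[OF s']]
    by (simp add: cov is_nanoword_def)
qed

theorem theorem10p5:
  fixes \<Gamma> :: "nanoword set" and \<alpha> :: nanoword and n r k :: nat
  assumes "\<Gamma> \<in> virtual_strings" and "\<alpha> \<in> \<Gamma>"
    and "n \<ge> 1"
    and "k = (if r = 0 then 0 else r div gcd n r)"
  shows "homotopic (cable n (covering k \<alpha>)) (covering r (cable n \<alpha>))"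
proof -
  \<comment> \<open>Classes consist of nanowords, because \<open>homotopic\<close> demands this of
    both its arguments.\<close>
  have "is_nanoword \<alpha>"
    using assms(1,2) by (auto simp: virtual_strings_def quotient_def homotopic_def)
  \<comment> \<open>Equal nanowords are homotopic by the empty sequence of steps.\<close>
  then show ?thesis
    using cable_covering[OF _ assms(3,4)] by (simp add: homotopic_def)
qed

end
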